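(* Let $H\subset\operatorname{GL}(V)$ be a complex algebraic torus acting on the finite-dimensional space $V$ with $V^H=(0)$, let $v\in V$, and let $G\subset\operatorname{Aff}(V)$ be the subgroup of affine transformations preserving $Hv$. Then (1) $G\subset\operatorname{GL}(V)$; (2) if $v$ is generic, then $G^0=H$.
   Context: $\operatorname{Aff}(V)=\operatorname{GL}(V)\ltimes V$ is the group of affine transformations of $V$. With $V=\bigoplus_i n_iV_i$ the isotypic decomposition under $H$ and $v=(v_{ij})$, $v_{ij}$ the component in the $j$th copy of $V_i$, $v$ is called generic if for each $i$ the vectors $v_{i1},\dots,v_{in_i}$ span an $n_i$-dimensional subspace of $V_i$ (equivalently, $Hv$ spans $V$). $G^0$ denotes the identity component. *)

theory Defs
  imports "HOL-Analysis.Analysis"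
begin

definition diag_mat :: "('n::finite \<Rightarrow> complex) \<Rightarrow> complex^'n^'n" where
  "diag_mat d = (\<chi> i j. if i = j then d i else 0)"

text \<open>A complex algebraic torus in GL(V): the image of (C^*)^r under a morphism of algebraic
  groups (C^*)^r -> GL(V); such morphisms are exactly t |-> P diag(t^{a_1},...,t^{a_n}) P^{-1}
  with integer exponent vectors a_i.\<close>
definition is_torus :: "(complex^'n::finite^'n) set \<Rightarrow> bool" where
  "is_torus H \<longleftrightarrow> (\<exists>(r::nat) (P::complex^'n^'n) (a::'n \<Rightarrow> nat \<Rightarrow> int).
     invertible P \<and>
     H = {P ** diag_mat (\<lambda>i. \<Prod>k<r. t k powi a i k) ** matrix_inv P | t. \<forall>k<r. t k \<noteq> 0})"

definition fixed_space :: "(complex^'n::finite^'n) set \<Rightarrow> (complex^'n) set" where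
  "fixed_space H = {x. \<forall>h\<in>H. h *v x = x}"

definition weight_space :: "(complex^'n::finite^'n) set \<Rightarrow> (complex^'n^'n \<Rightarrow> complex) \<Rightarrow> (complex^'n) set" where
  "weight_space H c = {x. \<forall>h\<in>H. h *v x = c h *s x}"

text \<open>Genericity w.r.t. the isotypic decomposition V = \<Oplus>_i n_i V_i (all V_i one-dimensional,
  H being a torus): for each isotypic component W = n_i V_i (nonzero weight space), the n_i
  components v_{i1},...,v_{in_i} \<in> V_i must span an n_i-dimensional subspace of the line V_i,
  i.e. n_i = dim W = 1 and the component of v in W is nonzero (v is not in the sum of the
  other isotypic components).\<close>
definition generic :: "(complex^'n::finite^'n) set \<Rightarrow> complex^'n \<Rightarrow> bool" where
  "generic H v \<longleftrightarrow> (\<forall>c. weight_space H c \<noteq> {0} \<longrightarrow>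
      vec.dim (weight_space H c) = 1 \<and>
      v \<notin> vec.span (\<Union>{weight_space H \<psi> | \<psi>. \<exists>h\<in>H. \<psi> h \<noteq> c h}))"

definition aff_apply :: "(complex^'n::finite^'n) \<times> (complex^'n) \<Rightarrow> complex^'n \<Rightarrow> complex^'n" where
  "aff_apply g x = fst g *v x + snd g"

definition orbit_set :: "(complex^'n::finite^'n) set \<Rightarrow> complex^'n \<Rightarrow> (complex^'n) set" where
  "orbit_set H v = (\<lambda>h. h *v v) ` H"

definition preserving_group :: "(complex^'n::finite^'n) set \<Rightarrow> complex^'n \<Rightarrow> ((complex^'n^'n) \<times> (complex^'n)) set" where
  "preserving_group H v = {g. invertible (fst g) \<and> aff_apply g ` orbit_set H v = orbit_set H v}"

end

theory Submission
  imports Defs "HOL-Computational_Algebra.Fundamental_Theorem_Algebra"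
begin

text \<open>
  Diagonalise the torus, so that it acts on the i-th coordinate by a character. Along a generic
  one-parameter subgroup, each coordinate of the image of the orbit under an affine map
  preserving the orbit is a Laurent polynomial in one variable that either vanishes identically
  or has no zero on the punctured plane; in the latter case it is a monomial, by the fundamental
  theorem of algebra. The nonconstant terms all have nonzero exponent because there are no
  nonzero fixed vectors, so a nonzero translation part would make the coordinate constant on the
  orbit, which is impossible since the map is onto the orbit. For generic vectors the exponents
  are pairwise distinct, hence the linear part has exactly one nonzero entry in each row. For
  such matrices, having nonzero diagonal (an open condition) is the same as being diagonal (a
  closed condition). So the identity component consists of diagonal matrices, and these are
  determined by where they send the vector.
\<close>

section \<open>Laurent polynomials in one variable\<close>

text \<open>A large power \<open>z ^ N\<close> clears all negative exponents. Exponents may repeat,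
  so a coefficient is a sum over a fibre of \<open>e\<close>; the case split is there because
  \<open>nat\<close> truncates negative integers to 0.\<close>

lemma laurent_sum_eq_poly:
  fixes c :: "'j \<Rightarrow> complex" and e :: "'j \<Rightarrow> int"
  assumes "finite J"
  obtains N :: nat and p :: "complex poly"
  where "\<And>z. z \<noteq> 0 \<Longrightarrow> poly p z = z ^ N * (\<Sum>j\<in>J. c j * z powi e j)"
    and "\<And>k. (\<Sum>j\<in>{j\<in>J. e j = k}. c j) = (if k + int N < 0 then 0 else coeff p (nat (k + int N)))"
proof -
  define N where "N = (\<Sum>j\<in>J. nat \<bar>e j\<bar>)"
  have pos: "e j + int N \<ge> 0" if "j \<in> J" for j
  proof -
    have "nat \<bar>e j\<bar> \<le> N" unfolding N_def using assms that by (intro member_le_sum) auto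
    then show ?thesis by linarith
  qed
  define p where "p = (\<Sum>j\<in>J. monom (c j) (nat (e j + int N)))"
  show ?thesis
  proof
    fix z :: complex assume z: "z \<noteq> 0"
    have "c j * z ^ nat (e j + int N) = z ^ N * (c j * z powi e j)" if "j \<in> J" for j
    proof -
      have "z ^ nat (e j + int N) = z powi (e j + int N)"
        using pos[OF that] by (simp add: power_int_def)
      also have "\<dots> = z powi e j * z ^ N" using z by (simp add: power_int_add)
      finally show ?thesis by simp
    qed
    then show "poly p z = z ^ N * (\<Sum>j\<in>J. c j * z powi e j)"
      unfolding p_def by (simp only: poly_sum poly_monom sum_distrib_left cong: sum.cong)
  next
    fix k
    show "(\<Sum>j\<in>{j\<in>J. e j = k}. c j) = (if k + int N < 0 then 0 else coeff p (nat (k + int N)))"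
    proof (cases "k + int N < 0")
      case True
      then have "{j\<in>J. e j = k} = {}" using pos by fastforce
      then show ?thesis using True by (simp only: sum.empty if_True)
    next
      case False
      have "coeff p (nat (k + int N)) = (\<Sum>j\<in>J. if e j = k then c j else 0)"
        unfolding p_def coeff_sum using False pos
        by (intro sum.cong) (auto simp: nat_eq_iff)
      then show ?thesis using False assms by (simp add: sum.inter_filter)
    qed
  qed
qed

lemma laurent_sum_vanishing:
  fixes c :: "'j \<Rightarrow> complex" and e :: "'j \<Rightarrow> int"
  assumes "finite J" and "\<And>z. z \<noteq> 0 \<Longrightarrow> (\<Sum>j\<in>J. c j * z powi e j) = 0"
  shows "(\<Sum>j\<in>{j\<in>J. e j = k}. c j) = 0"
proof -
  obtain N p where p: "\<And>z. z \<noteq> 0 \<Longrightarrow> poly p z = z ^ N * (\<Sum>j\<in>J. c j * z powi e j)"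
    and co: "\<And>k. (\<Sum>j\<in>{j\<in>J. e j = k}. c j) = (if k + int N < 0 then 0 else coeff p (nat (k + int N)))"
    by (rule laurent_sum_eq_poly[OF assms(1), of c e]) (rule that)
  have "infinite (UNIV - {0 :: complex})" by (simp add: infinite_UNIV_char_0)
  moreover have "UNIV - {0} \<subseteq> {z. poly p z = 0}" using p assms(2) by auto
  ultimately have "p = 0" using poly_roots_finite finite_subset by blast
  then show ?thesis using co[of k] by simp
qed

text \<open>Once the power of the variable given by \<open>order 0 p\<close> is split off, the
  cofactor has no root at all, so it is constant and \<open>p\<close> is a monomial.\<close>

lemma poly_no_nonzero_root_coeff:
  fixes p :: "complex poly"
  assumes "\<And>z. z \<noteq> 0 \<Longrightarrow> poly p z \<noteq> 0"
  obtains n where "\<And>k. k \<noteq> n \<Longrightarrow> coeff p k = 0"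
proof -
  have "p \<noteq> 0" using assms[of 1] by auto
  then obtain q where q: "p = [:- 0, 1:] ^ order 0 p * q" "\<not> [:- 0, 1:] dvd q"
    using order_decomp by blast
  have "poly q z \<noteq> 0" for z
  proof (cases "z = 0")
    case True
    then show ?thesis using q(2) by (metis poly_eq_0_iff_dvd)
  next
    case False
    then show ?thesis using assms[of z] by (subst (asm) q(1)) auto
  qed
  then have "constant (poly q)" using fundamental_theorem_of_algebra by blast
  then have "degree q = 0" by (simp add: constant_degree)
  then obtain d where "q = [:d:]" using degree_eq_zeroE by blast
  then have "p = monom d (order 0 p)" using q(1) by (simp add: monom_altdef)
  then show thesis by (metis coeff_monom that)
qed

lemma laurent_sum_nonvanishing:
  fixes c :: "'j \<Rightarrow> complex" and e :: "'j \<Rightarrow> int"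
  assumes "finite J" and nz: "\<And>z. z \<noteq> 0 \<Longrightarrow> (\<Sum>j\<in>J. c j * z powi e j) \<noteq> 0"
  obtains n where "\<And>k. k \<noteq> n \<Longrightarrow> (\<Sum>j\<in>{j\<in>J. e j = k}. c j) = 0"
proof -
  obtain N p where p: "\<And>z. z \<noteq> 0 \<Longrightarrow> poly p z = z ^ N * (\<Sum>j\<in>J. c j * z powi e j)"
    and co: "\<And>k. (\<Sum>j\<in>{j\<in>J. e j = k}. c j) = (if k + int N < 0 then 0 else coeff p (nat (k + int N)))"
    by (rule laurent_sum_eq_poly[OF assms(1), of c e]) (rule that)
  obtain n where n: "\<And>k. k \<noteq> n \<Longrightarrow> coeff p k = 0"
    using poly_no_nonzero_root_coeff[of p] p nz by auto
  show thesis
  proof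
    \<comment> \<open>Undoing the factor \<open>z ^ N\<close> shifts the one surviving exponent from
      \<open>n\<close> to \<open>n - N\<close>.\<close>
    fix k assume "k \<noteq> int n - int N"
    then show "(\<Sum>j\<in>{j\<in>J. e j = k}. c j) = 0" unfolding co by (auto intro!: n)
  qed
qed

section \<open>Characters and one-parameter subgroups\<close>

text \<open>This reduces questions on the torus to one variable: a single one-parameter subgroup
  keeps finitely many nontrivial characters nontrivial. Each exponent vector is read as a nonzero
  integer polynomial, and some integer avoids the finitely many roots.\<close>

lemma separating_cocharacter:
  fixes F :: "(nat \<Rightarrow> int) set"
  assumes "finite F" and nz: "\<And>a. a \<in> F \<Longrightarrow> \<exists>k<r. a k \<noteq> 0"
  obtains m where "\<And>a. a \<in> F \<Longrightarrow> (\<Sum>k<r. a k * m k) \<noteq> 0"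
proof -
  define p where "p a = (\<Sum>k<r. monom (a k) k)" for a :: "nat \<Rightarrow> int"
  have "p a \<noteq> 0" if "a \<in> F" for a
  proof -
    obtain k where k: "k < r" "a k \<noteq> 0" using nz[OF \<open>a \<in> F\<close>] by blast
    have "coeff (p a) k = (\<Sum>l<r. if l = k then a l else 0)"
      by (auto simp: p_def coeff_sum intro: sum.cong)
    then have "coeff (p a) k = a k" using k by simp
    then show ?thesis using k by auto
  qed
  then have "finite (\<Union>a\<in>F. {x. poly (p a) x = 0})" using assms(1) poly_roots_finite by blast
  then obtain x where x: "x \<notin> (\<Union>a\<in>F. {x. poly (p a) x = 0})"
    using ex_new_if_finite infinite_UNIV_int by blast
  show thesis
  \<comment> \<open>With exponents \<open>m k = x ^ k\<close>, pairing with \<open>a\<close> evaluates the polynomial with coefficients \<open>a\<close> at \<open>x\<close>.\<close>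
  proof
    fix a assume "a \<in> F"
    then show "(\<Sum>k<r. a k * x ^ k) \<noteq> 0" using x by (simp add: p_def poly_sum poly_monom)
  qed
qed

definition character :: "nat \<Rightarrow> (nat \<Rightarrow> int) \<Rightarrow> (nat \<Rightarrow> complex) \<Rightarrow> complex" where
  "character r a t = (\<Prod>k<r. t k powi a k)"

lemma character_nonzero: "\<forall>k<r. t k \<noteq> 0 \<Longrightarrow> character r a t \<noteq> 0"
  by (auto simp: character_def)

lemma character_mult:
  "character r a (\<lambda>k. s k * t k) = character r a s * character r a t"
  by (simp add: character_def power_int_mult_distrib prod.distrib)

lemma character_one [simp]: "character r a (\<lambda>k. 1) = 1"
  by (simp add: character_def)

lemma power_int_sum:
  fixes z :: "'a::field"
  assumes "z \<noteq> 0" "finite K"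
  shows "z powi (\<Sum>k\<in>K. f k) = (\<Prod>k\<in>K. z powi f k)"
  using assms(2) by induction (auto simp: power_int_add assms(1))

lemma character_cocharacter:
  assumes "z \<noteq> 0"
  shows "character r a (\<lambda>k. z powi m k) = z powi (\<Sum>k<r. a k * m k)"
  using assms by (simp add: character_def power_int_sum power_int_mult[symmetric] mult.commute)


section \<open>Laurent polynomials with a separate constant term\<close>

text \<open>The constant becomes one more term, with index \<open>None\<close> and exponent 0, so
  that the previous lemmas apply.\<close>

lemma laurent_sum_plus_const_eq:
  fixes c :: "'j \<Rightarrow> complex" and e :: "'j \<Rightarrow> int"
  assumes "finite J"
  shows "(\<Sum>j\<in>insert None (Some ` J). case_option b c j * z powi case_option 0 e j)
    = (\<Sum>j\<in>J. c j * z powi e j) + b"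
  using assms by (subst sum.insert) (auto simp: sum.reindex)

lemma laurent_sum_plus_const_vanishing:
  fixes c :: "'j \<Rightarrow> complex" and e :: "'j \<Rightarrow> int"
  assumes "finite J" and e: "\<And>j. j \<in> J \<Longrightarrow> e j \<noteq> 0"
    and z: "\<And>z. z \<noteq> 0 \<Longrightarrow> (\<Sum>j\<in>J. c j * z powi e j) + b = 0"
  shows "b = 0"
proof -
  let ?J = "insert None (Some ` J)"
  have "(\<Sum>j\<in>{j\<in>?J. case_option 0 e j = 0}. case_option b c j) = 0"
    using assms(1) z laurent_sum_plus_const_eq[OF assms(1), of b c _ e]
    by (intro laurent_sum_vanishing) (blast, metis)
  moreover have "{j\<in>?J. case_option 0 e j = 0} = {None}" using e by force
  ultimately show ?thesis by simp
qed

text \<open>The whole expression is a monomial, and its coefficient \<open>b\<close> at exponent 0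
  is nonzero, so every other grouped coefficient vanishes. The conclusion is the value of the
  nonconstant part at \<open>z = 1\<close>.\<close>

lemma laurent_sum_plus_const_nonvanishing:
  fixes c :: "'j \<Rightarrow> complex" and e :: "'j \<Rightarrow> int"
  assumes "finite J" and e: "\<And>j. j \<in> J \<Longrightarrow> e j \<noteq> 0"
    and nz: "\<And>z. z \<noteq> 0 \<Longrightarrow> (\<Sum>j\<in>J. c j * z powi e j) + b \<noteq> 0"
    and "b \<noteq> 0"
  shows "(\<Sum>j\<in>J. c j) = 0"
proof -
  let ?J = "insert None (Some ` J)"
  obtain n where n: "\<And>k. k \<noteq> n \<Longrightarrow> (\<Sum>j\<in>{j\<in>?J. case_option 0 e j = k}. case_option b c j) = 0"
  proof (rule laurent_sum_nonvanishing)
    show "finite ?J" using assms(1) by simp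
    show "(\<Sum>j\<in>?J. case_option b c j * z powi case_option 0 e j) \<noteq> 0" if "z \<noteq> 0" for z
      using nz[OF that] by (simp only: laurent_sum_plus_const_eq[OF assms(1)] not_False_eq_True)
  qed (rule that)
  have "{j\<in>?J. case_option 0 e j = 0} = {None}" using e by force
  then have "n = 0" using n[of 0] \<open>b \<noteq> 0\<close> by auto
  have "(\<Sum>j\<in>{j\<in>J. e j = k}. c j) = 0" if "k \<noteq> 0" for k
  proof -
    have "{j\<in>?J. case_option 0 e j = k} = Some ` {j\<in>J. e j = k}" using that by auto
    then show ?thesis using n[of k] that \<open>n = 0\<close> by (simp add: sum.reindex)
  qed
  moreover have "(\<Sum>j\<in>J. c j) = (\<Sum>k\<in>e ` J. \<Sum>j\<in>{j\<in>J. e j = k}. c j)"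
    using assms(1) by (rule sum.image_gen)
  ultimately show ?thesis using e by (auto intro: sum.neutral)
qed

section \<open>The torus in diagonalising coordinates\<close>

lemma diag_mat_mult_vec: "diag_mat d *v x = (\<chi> i. d i * x $ i)"
  by (simp add: diag_mat_def matrix_vector_mult_def vec_eq_iff if_distrib[of "\<lambda>y. y * _"] cong: if_cong)

lemma matrix_inv_inverse:
  assumes "invertible A"
  shows "A ** matrix_inv A = mat 1" "matrix_inv A ** A = mat 1"
  using assms someI_ex[of "\<lambda>A'. A ** A' = mat 1 \<and> A' ** A = mat 1"]
  by (auto simp: invertible_def matrix_inv_def)

text \<open>The columns of \<open>P\<close> are common eigenvectors of the torus, and
  \<open>a i\<close> is the exponent vector of the character on the \<open>i\<close>-th
  column.\<close>

locale diagonalized_torus =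
  fixes r :: nat and P :: "complex^'n::finite^'n" and a :: "'n \<Rightarrow> nat \<Rightarrow> int"
  assumes invertible_P: "invertible P"
begin

definition "Q = matrix_inv P"

definition chi :: "(nat \<Rightarrow> complex) \<Rightarrow> 'n \<Rightarrow> complex" where
  "chi t i = character r (a i) t"

definition elt :: "(nat \<Rightarrow> complex) \<Rightarrow> complex^'n^'n" where
  "elt t = P ** diag_mat (chi t) ** Q"

definition T :: "(nat \<Rightarrow> complex) set" where
  "T = {t. \<forall>k<r. t k \<noteq> 0}"

definition torus :: "(complex^'n^'n) set" where
  "torus = elt ` T"

lemma PQ: "P ** Q = mat 1" and QP: "Q ** P = mat 1"
  using matrix_inv_inverse[OF invertible_P] by (auto simp: Q_def)

lemma PQv [simp]: "P *v (Q *v x) = x" and QPv [simp]: "Q *v (P *v x) = x"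
  by (simp_all add: matrix_vector_mul_assoc PQ QP)

lemma elt_mult_vec: "elt t *v x = P *v (\<chi> i. chi t i * (Q *v x) $ i)"
  by (simp add: elt_def matrix_vector_mul_assoc[symmetric] diag_mat_mult_vec)

lemma one_in_T [simp]: "(\<lambda>k. 1) \<in> T"
  by (simp add: T_def)

lemma mult_in_T: "s \<in> T \<Longrightarrow> t \<in> T \<Longrightarrow> (\<lambda>k. s k * t k) \<in> T"
  by (simp add: T_def)

lemma cocharacter_in_T: "z \<noteq> 0 \<Longrightarrow> (\<lambda>k. z powi m k) \<in> T"
  by (simp add: T_def)

lemma chi_one [simp]: "chi (\<lambda>k. 1) i = 1"
  by (simp add: chi_def)

lemma chi_mult: "chi (\<lambda>k. s k * t k) i = chi s i * chi t i"
  by (simp add: chi_def character_mult)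

lemma chi_nonzero: "t \<in> T \<Longrightarrow> chi t i \<noteq> 0"
  by (simp add: chi_def T_def character_nonzero)

lemma chi_cong: "(\<And>k. k < r \<Longrightarrow> s k = t k) \<Longrightarrow> chi s = chi t"
  by (auto simp: chi_def character_def)

lemma elt_one: "elt (\<lambda>k. 1) = mat 1"
  by (simp add: matrix_eq elt_mult_vec)

lemma elt_mult: "elt s ** elt t = elt (\<lambda>k. s k * t k)"
  by (simp add: matrix_eq matrix_vector_mul_assoc[symmetric] elt_mult_vec chi_mult mult.assoc)

lemma elt_inverse:
  assumes "t \<in> T"
  obtains s where "s \<in> T" "elt s ** elt t = mat 1" "elt t ** elt s = mat 1"
proof
  let ?s = "\<lambda>k. inverse (t k)"
  show "?s \<in> T" using assms by (simp add: T_def)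
  \<comment> \<open>The two parameters need agree only below \<open>r\<close>: entries from
    \<open>r\<close> on are unconstrained and may be 0.\<close>
  have "elt (\<lambda>k. t k * ?s k) = elt (\<lambda>k. 1)"
    unfolding elt_def using assms by (subst chi_cong[of _ "\<lambda>k. 1"]) (auto simp: T_def)
  then show "elt ?s ** elt t = mat 1" "elt t ** elt ?s = mat 1"
    by (simp_all add: elt_mult elt_one mult.commute)
qed

lemma orbit_torus: "orbit_set torus v = (\<lambda>t. elt t *v v) ` T"
  by (auto simp: orbit_set_def torus_def)

lemma torus_subset_preserving_group:
  assumes "t \<in> T"
  shows "(elt t, 0) \<in> preserving_group torus v"
proof -
  obtain s where s: "s \<in> T" "elt s ** elt t = mat 1" "elt t ** elt s = mat 1"
    using elt_inverse[OF assms] .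
  have sub: "(\<lambda>x. elt u *v x) ` orbit_set torus v \<subseteq> orbit_set torus v" if "u \<in> T" for u
    using that by (auto simp: orbit_torus matrix_vector_mul_assoc elt_mult intro!: imageI mult_in_T)
  have "orbit_set torus v \<subseteq> (\<lambda>x. elt t *v x) ` orbit_set torus v"
  proof
    fix x assume "x \<in> orbit_set torus v"
    then have "elt s *v x \<in> orbit_set torus v" using sub[OF s(1)] by auto
    moreover have "x = elt t *v (elt s *v x)" by (simp add: matrix_vector_mul_assoc s)
    ultimately show "x \<in> (\<lambda>x. elt t *v x) ` orbit_set torus v" by (rule rev_image_eqI)
  qed
  then show ?thesis using sub[OF assms] s
    by (auto simp: preserving_group_def aff_apply_def[abs_def] invertible_def)
qed

section \<open>Affine maps preserving the orbit\<close>

lemma affine_in_coordinates: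
  "(Q *v (A *v (elt t *v v) + b)) $ i =
    (\<Sum>j\<in>UNIV. (Q ** A ** P) $ i $ j * (chi t j * (Q *v v) $ j)) + (Q *v b) $ i"
proof -
  have "Q *v (A *v (elt t *v v) + b) = (Q ** A ** P) *v (\<chi> j. chi t j * (Q *v v) $ j) + Q *v b"
    by (simp add: elt_mult_vec matrix_vector_mul_assoc matrix_vector_right_distrib matrix_mul_assoc)
  then show ?thesis by (simp add: matrix_vector_mult_def[of "Q ** A ** P"])
qed

lemma coordinates_elt: "(Q *v (elt s *v v)) $ i = chi s i * (Q *v v) $ i"
  by (simp add: elt_mult_vec)

lemma preserving_groupD1:
  assumes "(A, b) \<in> preserving_group torus v" "t \<in> T"
  obtains s where "s \<in> T"
    "\<And>i. (\<Sum>j\<in>UNIV. (Q ** A ** P) $ i $ j * (chi t j * (Q *v v) $ j)) + (Q *v b) $ i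
      = chi s i * (Q *v v) $ i"
proof -
  have "A *v (elt t *v v) + b \<in> orbit_set torus v"
    using assms by (auto simp: preserving_group_def aff_apply_def[abs_def] orbit_torus)
  then obtain s where "s \<in> T" "A *v (elt t *v v) + b = elt s *v v" by (auto simp: orbit_torus)
  then show thesis using that affine_in_coordinates coordinates_elt by metis
qed

text \<open>The orbit is contained in its image; this surjectivity is what excludes a nonzero
  translation part.\<close>

lemma preserving_groupD2:
  assumes "(A, b) \<in> preserving_group torus v" "s \<in> T"
  obtains t where "t \<in> T"
    "\<And>i. (\<Sum>j\<in>UNIV. (Q ** A ** P) $ i $ j * (chi t j * (Q *v v) $ j)) + (Q *v b) $ i
      = chi s i * (Q *v v) $ i"
proof -
  have "elt s *v v \<in> aff_apply (A, b) ` orbit_set torus v"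
    using assms by (auto simp: preserving_group_def orbit_torus)
  then obtain t where "t \<in> T" "A *v (elt t *v v) + b = elt s *v v"
    by (auto simp: orbit_torus aff_apply_def)
  then show thesis using that affine_in_coordinates coordinates_elt by metis
qed

lemma translation_part_zero:
  assumes nontriv: "\<And>i. \<exists>k<r. a i k \<noteq> 0" and g: "(A, b) \<in> preserving_group torus v"
  shows "b = 0"
proof -
  obtain m where m: "\<And>c. c \<in> range a \<Longrightarrow> (\<Sum>k<r. c k * m k) \<noteq> 0"
  proof (rule separating_cocharacter)
    show "\<exists>k<r. c k \<noteq> 0" if "c \<in> range a" for c using that nontriv by auto
  qed auto
  define e where "e i = (\<Sum>k<r. a i k * m k)" for i
  have e: "e i \<noteq> 0" for i using m by (simp add: e_def)
  define B where "B = Q ** A ** P"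
  define w where "w = Q *v v"
  have chi_e: "chi (\<lambda>k. s k * z powi m k) i = chi s i * z powi e i" if "z \<noteq> 0" for s z i
    using that unfolding chi_mult by (simp add: chi_def character_cocharacter e_def)
  \<comment> \<open>The base point \<open>s\<close> stays free: one one-parameter subgroup need not
    fill the torus, but its translates do.\<close>
  have fwd: "\<exists>u\<in>T. \<forall>i. (\<Sum>j\<in>UNIV. (B $ i $ j * chi s j * w $ j) * z powi e j) + (Q *v b) $ i
      = chi u i * w $ i"
    if "z \<noteq> 0" "s \<in> T" for z s
  proof -
    have "(\<lambda>k. s k * z powi m k) \<in> T" using that by (intro mult_in_T cocharacter_in_T)
    from preserving_groupD1[OF g this] obtain u where "u \<in> T"
      "\<And>i. (\<Sum>j\<in>UNIV. B $ i $ j * (chi s j * z powi e j * w $ j)) + (Q *v b) $ i = chi u i * w $ i"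
      unfolding B_def[symmetric] w_def[symmetric] chi_e[OF \<open>z \<noteq> 0\<close>] by blast
    then show ?thesis by (intro bexI[of _ u]) (simp_all add: mult_ac)
  qed
  have "(Q *v b) $ i = 0" for i
  proof (cases "w $ i = 0")
    case True
    show ?thesis
    proof (rule laurent_sum_plus_const_vanishing)
      show "(\<Sum>j\<in>UNIV. (B $ i $ j * chi (\<lambda>k. 1) j * w $ j) * z powi e j) + (Q *v b) $ i = 0" if "z \<noteq> 0" for z
        using fwd[OF that one_in_T] True by auto
    qed (use e in auto)
  next
    case False
    show ?thesis
    proof (rule ccontr)
      assume b: "(Q *v b) $ i \<noteq> 0"
      \<comment> \<open>Coordinate \<open>i\<close> never vanishes on the orbit, so along each
        translate the image coordinate is a monomial; a nonzero constant term leaves room for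
        nothing else.\<close>
      have const: "(\<Sum>j\<in>UNIV. B $ i $ j * chi s j * w $ j) = 0" if s: "s \<in> T" for s
      proof (rule laurent_sum_plus_const_nonvanishing)
        show "(\<Sum>j\<in>UNIV. (B $ i $ j * chi s j * w $ j) * z powi e j) + (Q *v b) $ i \<noteq> 0" if "z \<noteq> 0" for z
        proof -
          obtain u where "u \<in> T"
            "(\<Sum>j\<in>UNIV. (B $ i $ j * chi s j * w $ j) * z powi e j) + (Q *v b) $ i = chi u i * w $ i"
            using fwd[OF \<open>z \<noteq> 0\<close> s] by blast
          then show ?thesis using False chi_nonzero[of u i] by simp
        qed
      qed (use e b in auto)
      \<comment> \<open>Every orbit point is the image of an orbit point, so coordinate
        \<open>i\<close> is constant on the orbit.\<close>
      have "chi s i * w $ i = (Q *v b) $ i" if "s \<in> T" for s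
      proof -
        obtain t where t: "t \<in> T"
          "\<And>i. (\<Sum>j\<in>UNIV. B $ i $ j * (chi t j * w $ j)) + (Q *v b) $ i = chi s i * w $ i"
          using preserving_groupD2[OF g \<open>s \<in> T\<close>] unfolding B_def[symmetric] w_def[symmetric] by blast
        then show ?thesis using const[OF t(1)] t(2)[of i] by (simp add: mult.assoc)
      qed
      \<comment> \<open>Comparing the parameters \<open>z = 1\<close> and \<open>z = 2\<close> would
        force \<open>2 powi e i = 1\<close>, hence \<open>e i = 0\<close>.\<close>
      from this[OF one_in_T] this[OF cocharacter_in_T[of 2 m]]
      have "chi (\<lambda>k. 2 powi m k) i = 1" using False by auto
      then have "(2::complex) powi e i = 1" by (simp add: chi_def character_cocharacter e_def)
      then have "norm ((2::complex) powi e i) = 1" by simp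
      then have "(2::real) powi e i = 1" by (simp add: norm_power_int)
      then show False
        using e[of i] power_int_strict_increasing[of 0 "e i" "2::real"]
          power_int_strict_increasing[of "e i" 0 "2::real"] by (cases "e i > 0") auto
    qed
  qed
  then have "Q *v b = 0" by (simp add: vec_eq_iff)
  then show ?thesis by (metis PQv matrix_vector_mult_0_right)
qed

text \<open>Each row gives a nowhere vanishing Laurent polynomial, hence a monomial. With distinct
  exponents no terms can cancel, so only one entry of the row survives.\<close>

lemma row_unique_nonzero:
  assumes dist: "\<And>i j. i \<noteq> j \<Longrightarrow> \<exists>k<r. a i k \<noteq> a j k"
    and w: "\<And>i. (Q *v v) $ i \<noteq> 0"
    and g: "(A, 0) \<in> preserving_group torus v"
  shows "\<exists>!j. (Q ** A ** P) $ i $ j \<noteq> 0"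
proof -
  \<comment> \<open>Separating the differences of the characters makes the exponents
    \<open>e i\<close> pairwise distinct.\<close>
  let ?F = "(\<lambda>(i, j) k. a i k - a j k) ` {(i, j). i \<noteq> j}"
  obtain m where m: "\<And>c. c \<in> ?F \<Longrightarrow> (\<Sum>k<r. c k * m k) \<noteq> 0"
  proof (rule separating_cocharacter)
    show "\<exists>k<r. c k \<noteq> 0" if "c \<in> ?F" for c using that dist by auto
  qed auto
  define e where "e i = (\<Sum>k<r. a i k * m k)" for i
  have e: "e i \<noteq> e j" if "i \<noteq> j" for i j
  proof -
    have "(\<Sum>k<r. (a i k - a j k) * m k) \<noteq> 0" using that by (intro m) auto
    then show ?thesis by (simp add: e_def left_diff_distrib sum_subtractf)
  qed
  define B where "B = Q ** A ** P"
  define w where "w = Q *v v"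
  have nz: "(\<Sum>j\<in>UNIV. (B $ i $ j * w $ j) * z powi e j) \<noteq> 0" if z: "z \<noteq> 0" for z
  proof -
    obtain s where s: "s \<in> T"
      "(\<Sum>j\<in>UNIV. B $ i $ j * (chi (\<lambda>k. z powi m k) j * w $ j)) + (Q *v 0) $ i
        = chi s i * w $ i"
      using preserving_groupD1[OF g cocharacter_in_T[OF z, of m]] unfolding B_def w_def by blast
    have "(\<Sum>j\<in>UNIV. (B $ i $ j * w $ j) * z powi e j) = chi s i * w $ i"
      using s(2) z by (simp add: chi_def character_cocharacter e_def mult_ac)
    then show ?thesis using chi_nonzero[OF s(1)] w by (simp add: w_def)
  qed
  obtain n where n: "\<And>k. k \<noteq> n \<Longrightarrow> (\<Sum>j\<in>{j\<in>UNIV. e j = k}. B $ i $ j * w $ j) = 0"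
    using laurent_sum_nonvanishing[of UNIV "\<lambda>j. B $ i $ j * w $ j" e] nz by auto
  have zero: "B $ i $ j = 0" if "e j \<noteq> n" for j
  proof -
    have "{l\<in>UNIV. e l = e j} = {j}" using e by auto
    then show ?thesis using n[OF that] w by (simp add: w_def)
  qed
  obtain j where j: "B $ i $ j \<noteq> 0" 
    using nz[of 1] by (metis (no_types, lifting) mult_zero_left sum.neutral zero_neq_one)
  show ?thesis unfolding B_def[symmetric]
    using j zero e by metis
qed

section \<open>The identity component\<close>

lemma connected_component_subset_torus:
  assumes nontriv: "\<And>i. \<exists>k<r. a i k \<noteq> 0"
    and dist: "\<And>i j. i \<noteq> j \<Longrightarrow> \<exists>k<r. a i k \<noteq> a j k"
    and w: "\<And>i. (Q *v v) $ i \<noteq> 0"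
  shows "connected_component_set (preserving_group torus v) (mat 1, 0) \<subseteq> (\<lambda>h. (h, 0)) ` torus"
proof -
  define C where "C = connected_component_set (preserving_group torus v) (mat 1, 0)"
  define B where "B g = Q ** fst g ** P" for g :: "(complex^'n^'n) \<times> (complex^'n)"
  have sub: "C \<subseteq> preserving_group torus v" by (simp add: C_def connected_component_subset)
  have one: "(mat 1, 0) \<in> C"
    using torus_subset_preserving_group[OF one_in_T] by (simp add: C_def elt_one)
  have cont: "continuous_on UNIV (\<lambda>g. B g $ i $ j)" for i j
    unfolding B_def matrix_matrix_mult_def by (simp, intro continuous_intros)
  have uniq: "\<exists>!j. B g $ i $ j \<noteq> 0" if "g \<in> C" for g i
  proof (cases g)
    case (Pair A b)
    then have "b = 0" using translation_part_zero[OF nontriv] that sub by blast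
    then show ?thesis using row_unique_nonzero[OF dist w, of A i] that sub Pair
      by (auto simp only: B_def fst_conv)
  qed
  define U where "U = C \<inter> (\<Inter>i. {g. B g $ i $ i \<noteq> 0})"
  \<comment> \<open>The definition of \<open>U\<close> shows that it is open in \<open>C\<close>,
    this description that it is closed.\<close>
  have U_eq: "U = C \<inter> (\<Inter>i. \<Inter>j\<in>-{i}. {g. B g $ i $ j = 0})"
  proof -
    have "(\<forall>i. B g $ i $ i \<noteq> 0) \<longleftrightarrow> (\<forall>i. \<forall>j\<in>-{i}. B g $ i $ j = 0)" if "g \<in> C" for g
      using uniq[OF that] by (metis ComplD ComplI singletonD singletonI)
    then show ?thesis by (auto simp: U_def)
  qed
  have "openin (top_of_set C) U" unfolding U_def
    by (intro openin_open_Int open_INT ballI open_Collect_neq cont continuous_on_const) auto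
  moreover have "closedin (top_of_set C) U" unfolding U_eq
    by (intro closedin_closed_Int closed_INT ballI closed_Collect_eq cont continuous_on_const)
  moreover have "connected C" by (simp add: C_def)
  moreover have "(mat 1, 0) \<in> U"
    using one by (simp add: U_def B_def QP) (simp add: mat_def)
  ultimately have "U = C" by (metis connected_clopen empty_iff)
  show ?thesis unfolding C_def[symmetric]
  proof
    fix g assume g: "g \<in> C"
    obtain A b where Ab: "g = (A, b)" by (cases g)
    have "b = 0" using translation_part_zero[OF nontriv] g sub Ab by blast
    have "g \<in> U" using g \<open>U = C\<close> by simp
    then have off: "B g $ i $ j = 0" if "j \<noteq> i" for i j
      using that unfolding U_eq by auto
    have A: "(A, 0) \<in> preserving_group torus v" using g sub Ab \<open>b = 0\<close> by auto
    \<comment> \<open>The image of \<open>v\<close> itself is \<open>elt s *v v\<close>. As no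
      coordinate of \<open>v\<close> vanishes, this fixes all diagonal entries.\<close>
    obtain s where s: "s \<in> T"
      "\<And>i. (\<Sum>j\<in>UNIV. (Q ** A ** P) $ i $ j * (chi (\<lambda>k. 1) j * (Q *v v) $ j)) + (Q *v 0) $ i
      = chi s i * (Q *v v) $ i" by (rule preserving_groupD1[OF A one_in_T]) (rule that)
    have diag: "B g $ i $ i = chi s i" for i
    proof -
      have "(\<Sum>j\<in>UNIV. B g $ i $ j * (Q *v v) $ j) = B g $ i $ i * (Q *v v) $ i"
        using off by (subst sum.remove[of _ i]) (auto intro!: sum.neutral)
      then show ?thesis using s(2)[of i] w[of i] by (simp add: B_def Ab)
    qed
    have "B g = diag_mat (chi s)" using off diag by (auto simp: diag_mat_def vec_eq_iff)
    then have "elt s = P ** (Q ** A ** P) ** Q" by (simp add: elt_def B_def Ab)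
    also have "\<dots> = (P ** Q) ** A ** (P ** Q)" by (simp add: matrix_mul_assoc)
    finally have "A = elt s" by (simp add: PQ)
    then show "g \<in> (\<lambda>h. (h, 0)) ` torus" using s(1) Ab \<open>b = 0\<close> by (simp add: torus_def)
  qed
qed

text \<open>Complex powers of the parameters give a path inside the torus from the identity to any
  of its elements.\<close>

lemma torus_subset_connected_component:
  "(\<lambda>h. (h, 0)) ` torus \<subseteq> connected_component_set (preserving_group torus v) (mat 1, 0)"
proof -
  have "(elt t, 0) \<in> connected_component_set (preserving_group torus v) (mat 1, 0)" if t: "t \<in> T" for t
  proof -
    \<comment> \<open>The exponential keeps every entry nonzero; at \<open>x = 1\<close> it returns
      \<open>t k\<close> wherever \<open>t k\<close> is nonzero, in particular for all
      \<open>k < r\<close>.\<close>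
    define p where "p x k = exp (of_real x * Ln (t k))" for x :: real and k
    have pT: "p x \<in> T" for x by (simp add: T_def p_def)
    let ?S = "(\<lambda>x. (elt (p x), 0 :: complex^'n)) ` {0..1}"
    have "continuous_on {0..1} (\<lambda>x. chi (p x) i)" for i
      unfolding chi_def character_def p_def by (intro continuous_intros) auto
    then have "continuous_on {0..1} (\<lambda>x. if i = j then chi (p x) i else 0)" for i j
      by (cases "i = j") auto
    then have "continuous_on {0..1} (\<lambda>x. diag_mat (chi (p x)))"
      unfolding diag_mat_def by (intro continuous_on_vec_lambda)
    then have "continuous_on {0..1} (\<lambda>x. elt (p x))"
      unfolding elt_def matrix_matrix_mult_def by (simp, intro continuous_intros)
    then have "connected ?S" by (intro connected_continuous_image continuous_intros) auto
    moreover have "?S \<subseteq> preserving_group torus v" using torus_subset_preserving_group pT by auto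
    moreover have "(mat 1, 0) \<in> ?S"
    proof -
      have "elt (p 0) = mat 1" using elt_one by (simp add: p_def[abs_def])
      then show ?thesis by (intro image_eqI[where x = 0]) auto
    qed
    moreover have "(elt t, 0) \<in> ?S"
    proof -
      have "chi (p 1) = chi t" using t by (intro chi_cong) (simp add: p_def T_def)
      then have "elt (p 1) = elt t" by (simp add: elt_def)
      then show ?thesis by (intro image_eqI[where x = 1]) auto
    qed
    ultimately show ?thesis unfolding mem_Collect_eq connected_component_def by (intro exI conjI)
  qed
  then show ?thesis by (auto simp: torus_def)
qed

section \<open>Weight vectors and genericity\<close>

lemma elt_mult_basis: "elt t *v (P *v axis i 1) = chi t i *s (P *v axis i 1)"
proof -
  have "(\<chi> j. chi t j * axis i 1 $ j) = chi t i *s (axis i 1 :: complex^'n)"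
    by (auto simp: vec_eq_iff axis_def)
  then show ?thesis by (simp add: elt_mult_vec vec.scale)
qed

lemma P_axis_nonzero: "P *v axis i 1 \<noteq> 0"
  by (metis QPv axis_eq_0_iff matrix_vector_mult_0_right zero_neq_one)

text \<open>A trivial character would make the \<open>i\<close>-th column of \<open>P\<close> a
  nonzero fixed vector.\<close>

lemma nontrivial_if_fixed_space_zero:
  assumes "fixed_space torus = {0}"
  shows "\<exists>k<r. a i k \<noteq> 0"
proof (rule ccontr)
  assume "\<not> ?thesis"
  then have "chi t i = 1" for t by (simp add: chi_def character_def)
  then have "P *v axis i 1 \<in> fixed_space torus"
    by (simp add: fixed_space_def torus_def elt_mult_basis)
  then show False using assms P_axis_nonzero by blast
qed

text \<open>\<open>weight_space\<close> expects a function of the matrix. The \<open>i\<close>-th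
  character is therefore read off from \<open>h\<close>, since several parameters \<open>t\<close>
  may give the same matrix.\<close>

definition weight :: "'n \<Rightarrow> complex^'n^'n \<Rightarrow> complex" where
  "weight i h = (Q *v (h *v (P *v axis i 1))) $ i"

lemma weight_elt: "weight i (elt t) = chi t i"
  by (simp add: weight_def elt_mult_vec axis_def)

lemma P_axis_in_weight_space:
  assumes "\<And>t. t \<in> T \<Longrightarrow> chi t j = chi t i"
  shows "P *v axis j 1 \<in> weight_space torus (weight i)"
  using assms by (auto simp: weight_space_def torus_def weight_elt elt_mult_basis)

text \<open>Two columns of \<open>P\<close> with the same character would be independent vectors in
  a weight space of dimension 1.\<close>

lemma generic_distinct_weights:
  assumes "generic torus v" "i \<noteq> j"
  shows "\<exists>t\<in>T. chi t i \<noteq> chi t j"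
proof (rule ccontr)
  assume "\<not> ?thesis"
  then have in_i: "P *v axis i 1 \<in> weight_space torus (weight i)"
    and in_j: "P *v axis j 1 \<in> weight_space torus (weight i)"
    by (auto intro!: P_axis_in_weight_space)
  have dim: "vec.dim (weight_space torus (weight i)) = 1"
    using assms(1) in_i P_axis_nonzero[of i] unfolding generic_def by blast
  have notin: "P *v axis i 1 \<notin> vec.span {P *v axis j 1}"
  proof
    assume "P *v axis i 1 \<in> vec.span {P *v axis j 1}"
    then obtain c where "P *v axis i 1 = c *s (P *v axis j 1)" by (auto simp: vec.span_singleton)
    then have "Q *v (P *v axis i 1) = c *s (Q *v (P *v axis j 1))" by (simp add: vec.scale)
    then have "axis i 1 $ i = (c *s axis j 1) $ i" by simp
    then show False using assms(2) by (simp add: axis_def)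
  qed
  then have "vec.independent {P *v axis i 1, P *v axis j 1}"
    using P_axis_nonzero[of j] by (auto simp: vec.independent_insert)
  then have "card {P *v axis i 1, P *v axis j 1} \<le> 1"
    using in_i in_j dim vec.independent_card_le_dim[of "{P *v axis i 1, P *v axis j 1}"] by fastforce
  moreover have "P *v axis i 1 \<noteq> P *v axis j 1" using notin vec.span_base by blast
  ultimately show False by simp
qed

text \<open>Otherwise \<open>v\<close> would be a combination of the other columns of
  \<open>P\<close>, which lie in weight spaces of different weights, and genericity forbids
  this.\<close>

lemma generic_coordinate_nonzero:
  assumes "generic torus v"
  shows "(Q *v v) $ i \<noteq> 0"
proof
  assume zero: "(Q *v v) $ i = 0"
  let ?X = "\<Union>{weight_space torus \<psi> | \<psi>. \<exists>h\<in>torus. \<psi> h \<noteq> weight i h}"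
  have mem: "P *v axis j 1 \<in> vec.span ?X" if "j \<noteq> i" for j
  proof -
    obtain t where "t \<in> T" "chi t j \<noteq> chi t i" using generic_distinct_weights[OF assms \<open>j \<noteq> i\<close>] by blast
    then have "\<exists>h\<in>torus. weight j h \<noteq> weight i h" by (auto simp: torus_def weight_elt)
    then have "P *v axis j 1 \<in> ?X" using P_axis_in_weight_space[of j j] by blast
    then show ?thesis by (rule vec.span_base)
  qed
  have "v = P *v (\<Sum>j\<in>UNIV. (Q *v v) $ j *s axis j 1)" by (simp add: basis_expansion)
  also have "\<dots> = (\<Sum>j\<in>UNIV. (Q *v v) $ j *s (P *v axis j 1))" by (simp add: vec.sum vec.scale)
  also have "\<dots> \<in> vec.span ?X"
  proof (rule vec.span_sum)
    show "(Q *v v) $ j *s (P *v axis j 1) \<in> vec.span ?X" for j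
      using mem zero by (cases "j = i") (auto intro: vec.span_scale vec.span_zero)
  qed
  finally have "v \<in> vec.span ?X" .
  moreover have "weight_space torus (weight i) \<noteq> {0}"
    using P_axis_in_weight_space[of i i] P_axis_nonzero[of i] by blast
  ultimately show False using assms unfolding generic_def by blast
qed

lemma generic_distinct_exponents:
  assumes "generic torus v" "i \<noteq> j"
  shows "\<exists>k<r. a i k \<noteq> a j k"
proof (rule ccontr)
  assume "\<not> ?thesis"
  then have "chi t i = chi t j" for t
    unfolding chi_def character_def by (intro prod.cong) auto
  then show False using generic_distinct_weights[OF assms] by blast
qed

end

section \<open>Transfer to an arbitrary torus\<close>

theorem theorem3p9:
  fixes H :: "(complex^'n::finite^'n) set" and v :: "complex^'n"
  assumes "is_torus H"
    and "fixed_space H = {0}"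
  shows "(\<forall>g\<in>preserving_group H v. snd g = 0)
    \<and> (generic H v \<longrightarrow>
         connected_component_set (preserving_group H v) (mat 1, 0) = (\<lambda>h. (h, 0)) ` H)"
proof -
  obtain r :: nat and P :: "complex^'n^'n" and a where P: "invertible P"
    and H: "H = {P ** diag_mat (\<lambda>i. \<Prod>k<r. t k powi a i k) ** matrix_inv P | t. \<forall>k<r. t k \<noteq> 0}"
    using assms(1) unfolding is_torus_def by blast
  interpret diagonalized_torus r P a using P by unfold_locales
  have "H = torus"
    unfolding H torus_def elt_def T_def Q_def chi_def[abs_def] character_def by auto
  note nontriv = nontrivial_if_fixed_space_zero[OF assms(2)[unfolded \<open>H = torus\<close>]]
  have "snd g = 0" if "g \<in> preserving_group torus v" for g
    using translation_part_zero[OF nontriv, of "fst g" "snd g"] that by simp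
  moreover have "connected_component_set (preserving_group torus v) (mat 1, 0) = (\<lambda>h. (h, 0)) ` torus"
    if gen: "generic torus v"
  proof (rule subset_antisym[OF connected_component_subset_torus torus_subset_connected_component])
    show "\<exists>k<r. a i k \<noteq> 0" for i by (rule nontriv)
    show "\<exists>k<r. a i k \<noteq> a j k" if "i \<noteq> j" for i j
      using generic_distinct_exponents[OF gen that] .
    show "(Q *v v) $ i \<noteq> 0" for i by (rule generic_coordinate_nonzero[OF gen])
  qed
  ultimately show ?thesis unfolding \<open>H = torus\<close> by blast
qed

end
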